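(* Let $p$ be a prime and $n$ a positive integer, and let $S:=\{\mathbf x\in\mathbb Z_p^n:\ \mathrm d(\mathbf x,\mathbf 1)\le p\sqrt n\}$. Then $\chi(\mathsf{Cay}(\mathbb Z_p^n,S))\ge \sqrt n/p^3$. Furthermore, for each fixed $p$ there is a constant $c_p>0$ such that for all sufficiently large $n$, $\alpha(\mathsf{Cay}(\mathbb Z_p^n,S))\ge c_p\,p^n$.
   Context: $\mathbb Z_p=\mathbb Z/p\mathbb Z$, $\mathbf 1$ is the all-ones vector in $\mathbb Z_p^n$, and $\mathrm d(\cdot,\cdot)$ is the Hamming distance (number of coordinates in which two vectors differ). $\mathsf{Cay}(\Gamma,S)$ is the Cayley digraph with arc $u\to v$ iff $v-u\in S$; $\chi$ and $\alpha$ (chromatic number and independence number) refer to its underlying undirected graph. *)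

theory Defs
  imports Complex_Main "HOL-Computational_Algebra.Primes"
begin

definition Zpn :: "nat \<Rightarrow> nat \<Rightarrow> (nat \<Rightarrow> nat) set" where
  "Zpn p n = {x. (\<forall>i<n. x i < p) \<and> (\<forall>i\<ge>n. x i = 0)}"

definition vsub :: "nat \<Rightarrow> nat \<Rightarrow> (nat \<Rightarrow> nat) \<Rightarrow> (nat \<Rightarrow> nat) \<Rightarrow> (nat \<Rightarrow> nat)" where
  "vsub p n v u = (\<lambda>i. if i < n then (v i + p - u i) mod p else 0)"

definition ones :: "nat \<Rightarrow> nat \<Rightarrow> (nat \<Rightarrow> nat)" where
  "ones p n = (\<lambda>i. if i < n then 1 mod p else 0)"

definition hamming :: "nat \<Rightarrow> (nat \<Rightarrow> nat) \<Rightarrow> (nat \<Rightarrow> nat) \<Rightarrow> nat" where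
  "hamming n x y = card {i. i < n \<and> x i \<noteq> y i}"

definition Sset :: "nat \<Rightarrow> nat \<Rightarrow> (nat \<Rightarrow> nat) set" where
  "Sset p n = {x \<in> Zpn p n. real (hamming n x (ones p n)) \<le> real p * sqrt (real n)}"

text \<open>Underlying simple undirected graph of Cay(Z_p^n, S): u ~ v iff u \<noteq> v and
  v - u \<in> S or u - v \<in> S (loops discarded).\<close>
definition cay_adj :: "nat \<Rightarrow> nat \<Rightarrow> (nat \<Rightarrow> nat) set \<Rightarrow> (nat \<Rightarrow> nat) \<Rightarrow> (nat \<Rightarrow> nat) \<Rightarrow> bool" where
  "cay_adj p n S u v \<longleftrightarrow> u \<noteq> v \<and> (vsub p n v u \<in> S \<or> vsub p n u v \<in> S)"

definition proper_colouring :: "'v set \<Rightarrow> ('v \<Rightarrow> 'v \<Rightarrow> bool) \<Rightarrow> nat \<Rightarrow> ('v \<Rightarrow> nat) \<Rightarrow> bool" where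
  "proper_colouring V E k c \<longleftrightarrow> (\<forall>v\<in>V. c v < k) \<and> (\<forall>u\<in>V. \<forall>v\<in>V. E u v \<longrightarrow> c u \<noteq> c v)"

definition chromatic_number :: "'v set \<Rightarrow> ('v \<Rightarrow> 'v \<Rightarrow> bool) \<Rightarrow> nat" where
  "chromatic_number V E = (LEAST k. \<exists>c. proper_colouring V E k c)"

definition independent_set :: "'v set \<Rightarrow> ('v \<Rightarrow> 'v \<Rightarrow> bool) \<Rightarrow> 'v set \<Rightarrow> bool" where
  "independent_set V E I \<longleftrightarrow> I \<subseteq> V \<and> (\<forall>u\<in>I. \<forall>v\<in>I. \<not> E u v)"

definition independence_number :: "'v set \<Rightarrow> ('v \<Rightarrow> 'v \<Rightarrow> bool) \<Rightarrow> nat" where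
  "independence_number V E = Max (card ` {I. independent_set V E I})"

end

theory Submission
  imports Defs "HOL-Number_Theory.Cong" "HOL-Analysis.Weierstrass_Theorems"
    "HOL-Combinatorics.Transposition"
begin

text \<open>
  Chromatic number. Consider partial vectors over \<open>\<int>\<^sub>p\<close> with at most \<open>s = \<lfloor>p \<surd>n\<rfloor>\<close> unspecified
  coordinates, ordered by extension, with the free action of \<open>X \<mapsto> X + 1\<close>. This poset is
  \<open>(s - 1)\<close>-connected, so a Borsuk-Ulam (Dold) argument shows that any equivariant labelling by
  \<open>\<int>\<^sub>p\<close> changes \<open>s\<close> times along some chain. In a proper colouring the colours of completions of
  \<open>X\<close> and of \<open>X + 1\<close> are disjoint, which makes the cyclic sequence of colour sets of
  \<open>X, X + 1, \<dots>, X + p - 1\<close> aperiodic and gives such a labelling; with \<open>k\<close> colours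
  it can change fewer than \<open>p k\<close> times along a chain. Hence \<open>s < p k\<close>.

  Independence number. The vectors with more than \<open>n/p + p \<surd>n\<close> zeros and at most \<open>n/p\<close> ones form
  an independent set. Its density is bounded below: the binomial distribution keeps a constant
  fraction of its mass when the window around the mean is moved by \<open>O(\<surd>n)\<close>, and among vectors with
  many zeros at least one of the \<open>p - 1\<close> nonzero values is taken at most \<open>n/p\<close> times.
\<close>

section \<open>Cochains on lists\<close>

text \<open>The simplicial coboundary: the alternating sum of \<open>\<phi>\<close> over the lists
  with one entry deleted. It is augmented, with value \<open>\<phi> []\<close> on one-element
  lists.\<close>

primrec cobd :: "('a list \<Rightarrow> int) \<Rightarrow> 'a list \<Rightarrow> int" where
  "cobd \<phi> [] = 0"
| "cobd \<phi> (x # xs) = \<phi> xs - cobd (\<lambda>ys. \<phi> (x # ys)) xs"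

text \<open>Dual of the prism operator
  \<open>[x\<^sub>0,\<dots>,x\<^sub>r] \<mapsto> \<Sum>\<^sub>l (-1)\<^sup>l [f x\<^sub>0,\<dots>,f x\<^sub>l, g x\<^sub>l,\<dots>,g x\<^sub>r]\<close>.\<close>

primrec prism :: "('a \<Rightarrow> 'a) \<Rightarrow> ('a \<Rightarrow> 'a) \<Rightarrow> ('a list \<Rightarrow> int) \<Rightarrow> 'a list \<Rightarrow> int" where
  "prism f g \<phi> [] = 0"
| "prism f g \<phi> (x # xs) = \<phi> (f x # g x # map g xs) - prism f g (\<lambda>ys. \<phi> (f x # ys)) xs"

lemma cobd_diff: "cobd (\<lambda>xs. \<phi> xs - \<psi> xs) xs = cobd \<phi> xs - cobd \<psi> xs"
  by (induction xs arbitrary: \<phi> \<psi>) auto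

lemma cobd_sum: "cobd (\<lambda>xs. \<Sum>j\<in>J. \<phi> j xs) xs = (\<Sum>j\<in>J. cobd (\<phi> j) xs)"
  by (induction xs arbitrary: \<phi>) (auto simp: sum_subtractf)

lemma cobd_scale: "cobd (\<lambda>xs. c * \<phi> xs) xs = c * cobd \<phi> xs"
  by (induction xs arbitrary: \<phi>) (auto simp: algebra_simps)

lemma cobd_map: "cobd (\<lambda>xs. \<phi> (map h xs)) xs = cobd \<phi> (map h xs)"
  by (induction xs arbitrary: \<phi>) auto

lemma prism_diff: "prism f g (\<lambda>xs. \<phi> xs - \<psi> xs) xs = prism f g \<phi> xs - prism f g \<psi> xs"
  by (induction xs arbitrary: \<phi> \<psi>) auto

lemma prism_scale: "prism f g (\<lambda>xs. c * \<phi> xs) xs = c * prism f g \<phi> xs"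
  by (induction xs arbitrary: \<phi>) (auto simp: algebra_simps)

text \<open>The prism operator is a chain homotopy between the maps induced by \<open>f\<close> and
  \<open>g\<close>; the induction applies the hypothesis to \<open>\<phi>\<close> with
  \<open>f x\<close> fixed in front.\<close>

lemma prism_homotopy:
  "prism f g (cobd \<phi>) xs + cobd (prism f g \<phi>) xs = \<phi> (map g xs) - \<phi> (map f xs)"
proof (induction xs arbitrary: \<phi>)
  case (Cons x xs)
  show ?case
    using Cons[of "\<lambda>ys. \<phi> (f x # ys)"] cobd_map[of "\<lambda>ys. \<phi> (f x # g x # ys)" g xs]
    by (simp add: prism_diff cobd_diff)
qed simp

text \<open>Only lists that occur in the prism sum are compared, so that cochains can later be
  compared on chains with few stars alone.\<close>

lemma prism_cong_mod:
  assumes "\<And>l. l < length xs \<Longrightarrow>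
    [\<phi> (map f (take (Suc l) xs) @ map g (drop l xs)) = \<psi> (map f (take (Suc l) xs) @ map g (drop l xs))] (mod m)"
  shows "[prism f g \<phi> xs = prism f g \<psi> xs] (mod m)"
  using assms
proof (induction xs arbitrary: \<phi> \<psi>)
  case (Cons x xs)
  have "[prism f g (\<lambda>ys. \<phi> (f x # ys)) xs = prism f g (\<lambda>ys. \<psi> (f x # ys)) xs] (mod m)"
    by (rule Cons.IH) (use Cons.prems[of "Suc _"] in auto)
  moreover have "[\<phi> (f x # g x # map g xs) = \<psi> (f x # g x # map g xs)] (mod m)"
    using Cons.prems[of 0] by simp
  ultimately show ?case by (simp add: cong_diff)
qed simp

section \<open>Cocycles of the cyclic group on lists of labels\<close>

definition desc :: "int \<Rightarrow> int \<Rightarrow> int" where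
  "desc a b = of_bool (b < a)"

definition carry :: "int \<Rightarrow> int \<Rightarrow> int \<Rightarrow> int" where
  "carry a b c = desc b c - desc a c + desc a b"

text \<open>On labels from \<open>{0..<p}\<close>, \<open>carry a b c\<close> is the carry of the addition
  \<open>(b - a) + (c - b)\<close> modulo \<open>p\<close>. It represents the generator of the second cohomology
  group of the cyclic group of order \<open>p\<close>; \<open>tau_even\<close> is the cup power of this cocycle
  (meaningful on lists of odd length), and \<open>tau_odd\<close> its cup product with the degree 1
  generator, a cocycle modulo \<open>p\<close> only. \<open>desc_tau\<close> and \<open>hd_tau\<close> are non-invariant primitives
  of \<open>tau_even\<close> and \<open>tau_odd\<close>.\<close>

fun tau_even :: "int list \<Rightarrow> int" where
  "tau_even (a # b # c # xs) = carry a b c * tau_even (c # xs)"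
| "tau_even xs = 1"

fun tau_odd :: "int list \<Rightarrow> int" where
  "tau_odd (a # b # xs) = (b - a) * tau_even (b # xs)"
| "tau_odd xs = 0"

fun desc_tau :: "int list \<Rightarrow> int" where
  "desc_tau (a # b # xs) = desc a b * tau_even (b # xs)"
| "desc_tau xs = 0"

definition hd_tau :: "int list \<Rightarrow> int" where
  "hd_tau xs = hd xs * tau_even xs"

lemma cobd_Cons: "cobd (\<lambda>ys. \<phi> (x # ys)) xs = \<phi> xs - cobd \<phi> (x # xs)"
  by simp

text \<open>\<open>carry\<close> is the coboundary of \<open>desc\<close> and hence satisfies the
  cocycle identity in \<open>x\<close>, \<open>b\<close>, \<open>c\<close>, \<open>d\<close>; the
  deletions further right reduce to it by the induction hypothesis for the tail.\<close>

lemma cobd_tau_even: "odd (length xs) \<Longrightarrow> cobd tau_even (x # xs) = 0"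
proof (induction "length xs" arbitrary: x xs rule: less_induct)
  case less
  show ?case
  proof (cases "length xs = 1")
    case True
    then obtain b where "xs = [b]" by (auto simp: length_Suc_conv)
    then show ?thesis by simp
  next
    case False
    with less.prems obtain b c d ys where xs: "xs = b # c # d # ys" and "even (length ys)"
      by (cases xs; cases "tl xs"; cases "tl (tl xs)") auto
    then have "cobd tau_even (c # d # ys) = 0"
      by (intro less.hyps) auto
    then have "cobd (\<lambda>zs. tau_even (c # zs)) (d # ys) = tau_even (d # ys)"
      by (simp only: cobd_Cons)
    then have "cobd (\<lambda>zs. carry x b c * tau_even (c # zs)) (d # ys) = carry x b c * tau_even (d # ys)"
      by (subst cobd_scale) simp
    then show ?thesis
      by (simp add: xs carry_def algebra_simps)
  qed
qed

text \<open>Product rule: as \<open>tau_even\<close> is closed, only the coboundary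
  \<open>b - a\<close> of the head label remains. In \<open>cobd_desc_tau\<close> it is likewise the
  coboundary \<open>carry\<close> of \<open>desc\<close>.\<close>

lemma cobd_hd_tau:
  assumes "odd (length xs)"
  shows "cobd hd_tau (x # xs) = tau_odd (x # xs)"
proof -
  obtain b ys where xs: "xs = b # ys" using assms by (cases xs) auto
  have "cobd (\<lambda>zs. tau_even (x # zs)) xs = tau_even xs"
    using cobd_tau_even[OF assms] by (simp only: cobd_Cons)
  then have "cobd (\<lambda>zs. hd_tau (x # zs)) xs = x * tau_even xs"
    by (simp add: hd_tau_def cobd_scale)
  then show ?thesis by (simp add: xs hd_tau_def algebra_simps)
qed

lemma cobd_desc_tau:
  assumes "odd (length xs)"
  shows "cobd desc_tau (x # y # xs) = tau_even (x # y # xs)"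
proof -
  obtain c ys where xs: "xs = c # ys" using assms by (cases xs) auto
  have "cobd (\<lambda>zs. tau_even (y # zs)) xs = tau_even xs"
    using cobd_tau_even[OF assms] by (simp only: cobd_Cons)
  then have "cobd (\<lambda>zs. desc_tau (x # y # zs)) xs = desc x y * tau_even xs"
    by (simp add: cobd_scale)
  then show ?thesis by (simp add: xs carry_def algebra_simps)
qed

text \<open>The cocycle is normalised: \<open>carry a a c\<close> and \<open>carry a b b\<close>
  vanish, and at odd length every adjacent pair lies in some \<open>carry\<close> factor.\<close>

lemma tau_even_eq_0:
  assumes "\<not> distinct_adj xs" "odd (length xs)"
  shows "tau_even xs = 0"
  using assms by (induction xs rule: tau_even.induct) (auto simp: carry_def desc_def)

lemma tau_odd_eq_0:
  assumes "\<not> distinct_adj xs" "even (length xs)"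
  shows "tau_odd xs = 0"
  using assms tau_even_eq_0[of "tl xs"] by (cases xs rule: tau_odd.cases) auto

definition rot :: "int \<Rightarrow> int \<Rightarrow> int" where
  "rot p a = (a + 1) mod p"

text \<open>Only \<open>p - 1\<close> wraps around, so \<open>desc\<close> changes by the difference
  of one function at \<open>b\<close> and at \<open>a\<close>; such a difference cancels in
  \<open>carry\<close>.\<close>

lemma desc_rot:
  assumes "a \<in> {0..<p}" "b \<in> {0..<p}"
  shows "desc (rot p a) (rot p b) = desc a b - of_bool (a = p - 1) + of_bool (b = p - 1)"
proof -
  have "rot p c = (if c = p - 1 then 0 else c + 1)" if "c \<in> {0..<p}" for c
    using that by (auto simp: rot_def)
  then show ?thesis using assms by (auto simp: desc_def)
qed

lemma tau_even_rot:
  assumes "set xs \<subseteq> {0..<p}"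
  shows "tau_even (map (rot p) xs) = tau_even xs"
  using assms
proof (induction xs rule: tau_even.induct)
  case (1 a b c xs)
  then have "carry (rot p a) (rot p b) (rot p c) = carry a b c"
    by (simp add: carry_def desc_rot)
  with 1 show ?case by simp
qed auto

lemma sum_rot:
  assumes "0 < p"
  shows "(\<Sum>j<p. (int a + int j) mod int p) = (\<Sum>j<p. int j)"
proof (induction a)
  case (Suc a)
  have "(\<Sum>j<p. (int (Suc a) + int j) mod int p) - (\<Sum>j<p. (int a + int j) mod int p)
    = (\<Sum>j<p. (int a + int (Suc j)) mod int p - (int a + int j) mod int p)"
    by (simp add: sum_subtractf algebra_simps)
  also have "\<dots> = 0"
    by (subst sum_lessThan_telescope) simp
  finally show ?case using Suc by simp
qed auto

text \<open>\<open>p * desc c d\<close> equals \<open>(d - c) mod p - (d - c)\<close>. Under all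
  shifts both arguments run through all residues, so the sum is \<open>p * ((b - a) mod p)\<close>:
  the norm of \<open>desc\<close> is the degree 1 class modulo \<open>p\<close>.\<close>

lemma sum_desc:
  assumes p: "0 < p" and "a \<in> {0..<int p}" "b \<in> {0..<int p}"
  shows "[(\<Sum>j<p. desc ((a + int j) mod int p) ((b + int j) mod int p)) = b - a] (mod int p)"
proof -
  have step: "int p * desc c d = (d - c) mod int p - (d - c)"
    if "c \<in> {0..<int p}" "d \<in> {0..<int p}" for c d
  proof (cases "d < c")
    case True
    then have "(d - c) mod int p = (d - c + int p) mod int p" by simp
    also have "\<dots> = d - c + int p" using that True by (intro mod_pos_pos_trivial) auto
    finally show ?thesis using True by (simp add: desc_def)
  qed (use that in \<open>auto simp: desc_def\<close>)
  have S: "(\<Sum>j<p. (c + int j) mod int p) = (\<Sum>j<p. int j)" if "c \<in> {0..<int p}" for c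
    using sum_rot[OF p, of "nat c"] that by simp
  have "int p * (\<Sum>j<p. desc ((a + int j) mod int p) ((b + int j) mod int p))
    = (\<Sum>j<p. (b - a) mod int p - ((b + int j) mod int p - (a + int j) mod int p))"
    unfolding sum_distrib_left
  proof (rule sum.cong)
    fix j
    have "((b + int j) mod int p - (a + int j) mod int p) mod int p = (b - a) mod int p"
      by (simp add: mod_diff_eq)
    then show "int p * desc ((a + int j) mod int p) ((b + int j) mod int p)
      = (b - a) mod int p - ((b + int j) mod int p - (a + int j) mod int p)"
      using p by (subst step) auto
  qed simp
  also have "\<dots> = int p * ((b - a) mod int p)"
    using S[OF assms(2)] S[OF assms(3)] by (simp add: sum_subtractf)
  finally show ?thesis using p by (simp add: cong_def)
qed

section \<open>Equivariant labellings of partial vectors\<close>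

text \<open>A partial vector is a function \<open>X\<close> of which only the coordinates \<open>i < n\<close> matter;
  a value \<open>X i \<ge> p\<close> is a star, that is, an unspecified coordinate.\<close>

definition pshift :: "nat \<Rightarrow> nat \<Rightarrow> (nat \<Rightarrow> nat) \<Rightarrow> nat \<Rightarrow> nat" where
  "pshift p n X = (\<lambda>i. if i < n \<and> X i < p then (X i + 1) mod p else X i)"

definition ple :: "nat \<Rightarrow> nat \<Rightarrow> (nat \<Rightarrow> nat) \<Rightarrow> (nat \<Rightarrow> nat) \<Rightarrow> bool" where
  "ple p n X Y \<longleftrightarrow> (\<forall>i<n. X i < p \<longrightarrow> Y i = X i)"

definition stars :: "nat \<Rightarrow> nat \<Rightarrow> (nat \<Rightarrow> nat) \<Rightarrow> nat" where
  "stars p n X = card {i. i < n \<and> p \<le> X i}"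

definition zero_below :: "nat \<Rightarrow> (nat \<Rightarrow> nat) \<Rightarrow> nat \<Rightarrow> nat" where
  "zero_below j X = (\<lambda>i. if i < j then 0 else X i)"

definition star_at :: "nat \<Rightarrow> nat \<Rightarrow> (nat \<Rightarrow> nat) \<Rightarrow> nat \<Rightarrow> nat" where
  "star_at p j X = (zero_below j X)(j := p)"

text \<open>Setting the coordinates to zero one at a time, through an intermediate star, contracts
  every chain while creating at most one more star.\<close>

definition contraction :: "nat \<Rightarrow> nat \<Rightarrow> ((nat \<Rightarrow> nat) list \<Rightarrow> int) \<Rightarrow> (nat \<Rightarrow> nat) list \<Rightarrow> int" where
  "contraction p n \<phi> xs = (\<Sum>j<n. prism (star_at p j) (zero_below j) \<phi> xs
      - prism (star_at p j) (zero_below (Suc j)) \<phi> xs)"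

text \<open>The differentials of the minimal resolution of the cyclic group: \<open>g - 1\<close> and the norm
  \<open>1 + g + \<dots> + g\<^bsup>p-1\<^esup>\<close> in turn, acting on cochains.\<close>

definition dres :: "nat \<Rightarrow> nat \<Rightarrow> nat \<Rightarrow> ((nat \<Rightarrow> nat) list \<Rightarrow> int) \<Rightarrow> (nat \<Rightarrow> nat) list \<Rightarrow> int" where
  "dres p n i \<phi> xs = (if even i then \<phi> (map (pshift p n) xs) - \<phi> xs
     else (\<Sum>j<p. \<phi> (map (pshift p n ^^ j) xs)))"

text \<open>The pairing \<open>\<phi> \<mapsto> \<langle>\<phi>, h\<^sub>i\<rangle>\<close> with chains \<open>h\<^sub>i\<close> whose boundary
  is the image of \<open>h\<^bsub>i-1\<^esub>\<close> under the differential of the resolution, up to multiples of \<open>p\<close>.\<close>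

primrec eval_chain :: "nat \<Rightarrow> nat \<Rightarrow> nat \<Rightarrow> ((nat \<Rightarrow> nat) list \<Rightarrow> int) \<Rightarrow> int" where
  "eval_chain p n 0 \<phi> = \<phi> [\<lambda>_. 0]"
| "eval_chain p n (Suc i) \<phi> = eval_chain p n i (dres p n i (contraction p n \<phi>))"

text \<open>Chains may repeat entries. The star bound equals the dimension because each application
  of \<open>contraction\<close> reads chains with one more entry and at most one more star.\<close>

definition pchain :: "nat \<Rightarrow> nat \<Rightarrow> nat \<Rightarrow> (nat \<Rightarrow> nat) list \<Rightarrow> bool" where
  "pchain p n i xs \<longleftrightarrow> length xs = Suc i \<and> sorted_wrt (ple p n) xs \<and> (\<forall>X\<in>set xs. stars p n X \<le> i)"

section \<open>Shifts, zeroing and stars along chains\<close>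

lemma pshift_funpow: "0 < p \<Longrightarrow> (pshift p n ^^ j) X = (\<lambda>i. if i < n \<and> X i < p then (X i + j) mod p else X i)"
proof (induction j)
  case 0
  then show ?case by (auto simp: fun_eq_iff)
next
  case (Suc j)
  have "(pshift p n ^^ Suc j) X = pshift p n (\<lambda>i. if i < n \<and> X i < p then (X i + j) mod p else X i)"
    using Suc by simp
  also have "\<dots> = (\<lambda>i. if i < n \<and> X i < p then (X i + Suc j) mod p else X i)"
    using Suc.prems by (auto simp: pshift_def fun_eq_iff mod_simps)
  finally show ?case .
qed

lemma pshift_funpow_p: "0 < p \<Longrightarrow> (pshift p n ^^ p) X = X"
  by (auto simp: pshift_funpow fun_eq_iff)

lemma stars_pshift_funpow:
  assumes "0 < p"
  shows "stars p n ((pshift p n ^^ j) X) = stars p n X"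
proof -
  have "p \<le> (pshift p n ^^ j) X i \<longleftrightarrow> p \<le> X i" for i
    using mod_less_divisor[OF assms, of "X i + j"] by (auto simp: pshift_funpow[OF assms] simp del: mod_less_divisor)
  then show ?thesis by (simp add: stars_def)
qed

lemma ple_pshift_funpow: "0 < p \<Longrightarrow> ple p n X Y \<Longrightarrow> ple p n ((pshift p n ^^ j) X) ((pshift p n ^^ j) Y)"
  by (auto simp: ple_def pshift_funpow)

lemma ple_refl: "ple p n X X"
  by (simp add: ple_def)

lemma ple_trans: "ple p n X Y \<Longrightarrow> ple p n Y Z \<Longrightarrow> ple p n X Z"
  by (auto simp: ple_def)

lemma pchain_map_pshift: "0 < p \<Longrightarrow> pchain p n i xs \<Longrightarrow> pchain p n i (map (pshift p n ^^ j) xs)"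
  by (auto simp: pchain_def sorted_wrt_map stars_pshift_funpow ple_pshift_funpow
      elim!: sorted_wrt_mono_rel[rotated])

lemma ple_zero_below: "ple p n X Y \<Longrightarrow> ple p n (zero_below j X) (zero_below j Y)"
  by (auto simp: ple_def zero_below_def)

lemma ple_star_at: "ple p n X Y \<Longrightarrow> ple p n (star_at p j X) (star_at p j Y)"
  by (auto simp: ple_def zero_below_def star_at_def)

lemma ple_star_at_zero_below:
  "ple p n (star_at p j X) (zero_below j X)" "ple p n (star_at p j X) (zero_below (Suc j) X)"
  by (auto simp: ple_def zero_below_def star_at_def)

lemma stars_zero_below: "0 < p \<Longrightarrow> stars p n (zero_below j X) \<le> stars p n X"
  unfolding stars_def by (rule card_mono) (auto simp: zero_below_def split: if_splits)

lemma stars_star_at: "0 < p \<Longrightarrow> stars p n (star_at p j X) \<le> Suc (stars p n X)"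
proof -
  assume p: "0 < p"
  have "stars p n (star_at p j X) \<le> card (insert j {i. i < n \<and> p \<le> X i})"
    unfolding stars_def using p by (intro card_mono) (auto simp: zero_below_def star_at_def split: if_splits)
  also have "\<dots> \<le> Suc (stars p n X)"
    unfolding stars_def by (rule card_insert_le_m1) auto
  finally show ?thesis .
qed

text \<open>The lists in a prism sum are again chains: an entry of the \<open>f\<close> part lies
  below one of the \<open>g\<close> part via \<open>f X \<le> f Y \<le> g Y\<close>.\<close>

lemma pchain_prism:
  assumes chain: "pchain p n i xs" and l: "l < length xs"
    and f: "\<And>X Y. ple p n X Y \<Longrightarrow> ple p n (f X) (f Y)"
    and g: "\<And>X Y. ple p n X Y \<Longrightarrow> ple p n (g X) (g Y)"
    and fg: "\<And>X. ple p n (f X) (g X)"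
    and st: "\<And>X. stars p n (f X) \<le> Suc (stars p n X)" "\<And>X. stars p n (g X) \<le> Suc (stars p n X)"
  shows "pchain p n (Suc i) (map f (take (Suc l) xs) @ map g (drop l xs))"
proof -
  have len: "length xs = Suc i" and sorted: "sorted_wrt (ple p n) xs"
    and stars: "\<And>X. X \<in> set xs \<Longrightarrow> stars p n X \<le> i"
    using chain by (auto simp: pchain_def)
  have le: "ple p n X Y" if X: "X \<in> set (take (Suc l) xs)" and Y: "Y \<in> set (drop l xs)" for X Y
  proof -
    obtain a where a: "a \<le> l" "X = xs ! a" using X l
      by (auto simp: in_set_conv_nth less_Suc_eq_le)
    obtain b where b: "b < length xs - l" "Y = xs ! (l + b)" using Y l
      by (auto simp: in_set_conv_nth)
    show ?thesis
    proof (cases "a = l + b")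
      case False
      then show ?thesis using a b l sorted by (auto simp: sorted_wrt_iff_nth_less)
    qed (use a b in \<open>simp add: ple_refl\<close>)
  qed
  have "sorted_wrt (ple p n) (take (Suc l) xs)" "sorted_wrt (ple p n) (drop l xs)"
    using sorted by (auto intro: sorted_wrt_take sorted_wrt_drop)
  then have "sorted_wrt (ple p n) (map f (take (Suc l) xs) @ map g (drop l xs))"
    unfolding sorted_wrt_append sorted_wrt_map
    by (auto elim!: sorted_wrt_mono_rel[rotated] intro: f g ple_trans[OF f[OF le] fg])
  moreover have "stars p n X \<le> Suc i" if "X \<in> set (map f (take (Suc l) xs) @ map g (drop l xs))" for X
    using that by (auto dest!: in_set_takeD in_set_dropD
        intro: order_trans[OF st(1)] order_trans[OF st(2)] stars)
  ultimately show ?thesis using len l by (auto simp: pchain_def)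
qed

section \<open>Pairing cochains with chains of bounded star number\<close>

lemma contraction_cong_mod:
  assumes "0 < p" "pchain p n i xs"
    and "\<And>ys. pchain p n (Suc i) ys \<Longrightarrow> [\<phi> ys = \<psi> ys] (mod m)"
  shows "[contraction p n \<phi> xs = contraction p n \<psi> xs] (mod m)"
proof -
  have "[prism (star_at p j) (zero_below k) \<phi> xs = prism (star_at p j) (zero_below k) \<psi> xs] (mod m)"
    if "k = j \<or> k = Suc j" for j k
    by (rule prism_cong_mod, rule assms(3), rule pchain_prism[OF assms(2)])
       (use that \<open>0 < p\<close> in \<open>auto intro: ple_star_at ple_zero_below ple_star_at_zero_below
          stars_star_at le_SucI stars_zero_below\<close>)
  then show ?thesis unfolding contraction_def
    by (intro cong_sum cong_diff) auto
qed

text \<open>The chains h_i consist of lists satisfying \<open>pchain p n i\<close>. Hence cochains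
  built from a labelling that is equivariant only below a star bound can be evaluated.\<close>

lemma eval_chain_cong_mod:
  assumes "0 < p" "\<And>xs. pchain p n i xs \<Longrightarrow> [\<phi> xs = \<psi> xs] (mod m)"
  shows "[eval_chain p n i \<phi> = eval_chain p n i \<psi>] (mod m)"
  using assms(2)
proof (induction i arbitrary: \<phi> \<psi>)
  case 0
  then show ?case using \<open>0 < p\<close> by (simp add: pchain_def stars_def)
next
  case (Suc i)
  have "[dres p n i (contraction p n \<phi>) xs = dres p n i (contraction p n \<psi>) xs] (mod m)"
    if "pchain p n i xs" for xs
    unfolding dres_def
    using that pchain_map_pshift[OF \<open>0 < p\<close> that] pchain_map_pshift[OF \<open>0 < p\<close> that, of 1]
    by (auto intro!: cong_sum cong_diff contraction_cong_mod[OF \<open>0 < p\<close>] Suc.prems)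
  then show ?case using Suc.IH by simp
qed

text \<open>For each \<open>j\<close> the two prisms share the lower end \<open>star_at p j\<close>,
  whose terms cancel; the rest telescopes from the identity \<open>zero_below 0\<close> to
  \<open>zero_below n\<close>.\<close>

lemma contraction_homotopy:
  "contraction p n (cobd \<phi>) xs = \<phi> xs - \<phi> (map (zero_below n) xs) - cobd (contraction p n \<phi>) xs"
proof -
  have "cobd (contraction p n \<phi>) xs = (\<Sum>j<n. cobd (prism (star_at p j) (zero_below j) \<phi>) xs
      - cobd (prism (star_at p j) (zero_below (Suc j)) \<phi>) xs)"
    unfolding contraction_def by (simp add: cobd_sum cobd_diff)
  then have "contraction p n (cobd \<phi>) xs + cobd (contraction p n \<phi>) xs
    = (\<Sum>j<n. (prism (star_at p j) (zero_below j) (cobd \<phi>) xs + cobd (prism (star_at p j) (zero_below j) \<phi>) xs)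
      - (prism (star_at p j) (zero_below (Suc j)) (cobd \<phi>) xs + cobd (prism (star_at p j) (zero_below (Suc j)) \<phi>) xs))"
    by (simp add: contraction_def algebra_simps flip: sum.distrib)
  also have "\<dots> = (\<Sum>j<n. \<phi> (map (zero_below j) xs) - \<phi> (map (zero_below (Suc j)) xs))"
    by (simp add: prism_homotopy)
  also have "\<dots> = \<phi> (map (zero_below 0) xs) - \<phi> (map (zero_below n) xs)"
    by (rule sum_lessThan_telescope')
  also have "map (zero_below 0) xs = xs"
    by (simp add: zero_below_def map_idI)
  finally show ?thesis by simp
qed

lemma contraction_diff:
  "contraction p n (\<lambda>xs. \<phi> xs - \<psi> xs) xs = contraction p n \<phi> xs - contraction p n \<psi> xs"
  by (simp add: contraction_def prism_diff flip: sum_subtractf) (simp add: algebra_simps)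

lemma contraction_scale: "contraction p n (\<lambda>xs. c * \<phi> xs) xs = c * contraction p n \<phi> xs"
  by (simp add: contraction_def prism_scale algebra_simps sum_distrib_left)

lemma dres_diff: "dres p n i (\<lambda>xs. \<phi> xs - \<psi> xs) xs = dres p n i \<phi> xs - dres p n i \<psi> xs"
  by (simp add: dres_def sum_subtractf)

lemma dres_scale: "dres p n i (\<lambda>xs. c * \<phi> xs) xs = c * dres p n i \<phi> xs"
  by (simp add: dres_def sum_distrib_left algebra_simps)

lemma eval_chain_diff:
  "eval_chain p n i (\<lambda>xs. \<phi> xs - \<psi> xs) = eval_chain p n i \<phi> - eval_chain p n i \<psi>"
  by (induction i arbitrary: \<phi> \<psi>) (simp_all add: contraction_diff[abs_def] dres_diff[abs_def])

lemma eval_chain_scale: "eval_chain p n i (\<lambda>xs. c * \<phi> xs) = c * eval_chain p n i \<phi>"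
  by (induction i arbitrary: \<phi>) (simp_all add: contraction_scale[abs_def] dres_scale[abs_def])

lemma dres_cobd: "dres p n i (cobd \<phi>) xs = cobd (dres p n i \<phi>) xs"
  by (cases "even i") (simp_all add: dres_def[abs_def] cobd_diff cobd_sum cobd_map)

text \<open>With g the shift, the product of g - 1 and the norm telescopes to g^p - 1 = 0.\<close>

lemma dres_dres:
  assumes "0 < p"
  shows "dres p n i (dres p n (Suc i) \<phi>) xs = 0"
proof -
  have *: "(\<Sum>j<p. \<phi> (map (pshift p n ^^ Suc j) ys) - \<phi> (map (pshift p n ^^ j) ys)) = 0" for ys
    using \<open>0 < p\<close> by (subst sum_lessThan_telescope) (simp add: pshift_funpow_p map_idI)
  show ?thesis
  proof (cases "even i")
    case True
    then show ?thesis using *[of xs]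
      by (simp add: dres_def funpow_Suc_right comp_assoc sum_subtractf del: funpow.simps)
  next
    case False
    then show ?thesis using *[of xs]
      by (simp add: dres_def)
  qed
qed

lemma zero_below_pshift: "0 < p \<Longrightarrow> zero_below n ((pshift p n ^^ j) X) = zero_below n X"
  by (auto simp: zero_below_def pshift_funpow fun_eq_iff)

text \<open>Zeroing all \<open>n\<close> coordinates absorbs the shift, so the norm adds
  \<open>p\<close> equal terms. This error is why \<open>eval_chain_cobd\<close> is a congruence
  modulo \<open>p\<close>.\<close>

lemma dres_zero_below:
  assumes "0 < p"
  shows "dres p n i (\<lambda>xs. \<phi> (map (zero_below n) xs)) xs = (if even i then 0 else int p * \<phi> (map (zero_below n) xs))"
  using zero_below_pshift[OF assms] zero_below_pshift[OF assms, of _ 1]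
  by (simp add: dres_def comp_def)

lemma eval_chain_zero: "eval_chain p n i (\<lambda>_. 0) = 0"
  using eval_chain_scale[of p n i 0 "\<lambda>_. 0"] by simp

text \<open>\<open>contraction_homotopy\<close> leaves \<open>\<phi>\<close>, a term that vanishes
  modulo \<open>p\<close>, and the coboundary of \<open>contraction p n \<phi>\<close>. The
  induction hypothesis turns the last into two consecutive differentials, hence 0.\<close>

lemma eval_chain_cobd:
  assumes "0 < p"
  shows "[eval_chain p n (Suc i) (cobd \<phi>) = eval_chain p n i (dres p n i \<phi>)] (mod int p)"
proof (induction i arbitrary: \<phi>)
  case (0 \<phi>)
  have "contraction p n \<phi> [] = 0" for \<phi> by (simp add: contraction_def)
  then show ?case using dres_zero_below[OF assms, of n 0 \<phi> "[\<lambda>_. 0]"]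
    by (simp add: contraction_homotopy[abs_def] dres_diff dres_cobd) (simp add: dres_def)
next
  case (Suc i \<phi>)
  let ?D = "dres p n (Suc i)" and ?E = "eval_chain p n (Suc i)"
  have "[?E (cobd (?D (contraction p n \<phi>))) = eval_chain p n i (dres p n i (?D (contraction p n \<phi>)))] (mod int p)"
    by (rule Suc.IH)
  also have "dres p n i (?D (contraction p n \<phi>)) = (\<lambda>_. 0)"
    using dres_dres[OF assms] by blast
  finally have 1: "[?E (cobd (?D (contraction p n \<phi>))) = 0] (mod int p)"
    by (simp only: eval_chain_zero)
  have "?D (\<lambda>xs. \<phi> (map (zero_below n) xs)) = (\<lambda>xs. (if even i then int p else 0) * \<phi> (map (zero_below n) xs))"
    by (auto simp: dres_zero_below[OF assms] fun_eq_iff)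
  then have 2: "[?E (?D (\<lambda>xs. \<phi> (map (zero_below n) xs))) = 0] (mod int p)"
    by (simp only: eval_chain_scale) (auto simp: cong_0_iff)
  have "eval_chain p n (Suc (Suc i)) (cobd \<phi>) =
    ?E (?D \<phi>) - ?E (?D (\<lambda>xs. \<phi> (map (zero_below n) xs))) - ?E (cobd (?D (contraction p n \<phi>)))"
    unfolding eval_chain.simps(2)[of p n "Suc i"] contraction_homotopy[abs_def]
    by (simp only: dres_diff[abs_def] eval_chain_diff dres_cobd[abs_def])
  then show ?case
    using cong_diff[OF cong_diff[OF cong_refl 2] 1, of "?E (?D \<phi>)"] by simp
qed

text \<open>Dold's argument: the cocycle of degree \<open>s\<close> pairs with h_s to 1 modulo
  \<open>p\<close>, as is seen by descending to degree 0. If every chain had two equal adjacent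
  labels, the cocycle would vanish on all of them.\<close>

lemma equivariant_chain_distinct_adj:
  fixes sgn :: "(nat \<Rightarrow> nat) \<Rightarrow> nat"
  assumes p: "2 \<le> p"
    and lt: "\<And>X. stars p n X \<le> s \<Longrightarrow> sgn X < p"
    and equiv: "\<And>X. stars p n X \<le> s \<Longrightarrow> sgn (pshift p n X) = Suc (sgn X) mod p"
  shows "\<exists>xs. pchain p n s xs \<and> distinct_adj (map sgn xs)"
proof -
  have p0: "0 < p" using p by simp
  define tau where "tau i = (if even i then tau_even else tau_odd)" for i :: nat
  define sg where "sg = map (\<lambda>X. int (sgn X))"
  have len: "length (sg xs) = length xs" for xs by (simp add: sg_def)
  have sg_map: "sg (map (pshift p n) xs) = map (rot (int p)) (sg xs)"
    if "\<forall>X\<in>set xs. stars p n X \<le> s" for xs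
    using that by (auto simp: sg_def equiv rot_def zmod_int add.commute)
  have sg_map_funpow: "sg (map (pshift p n ^^ j) xs) = map (\<lambda>a. (a + int j) mod int p) (sg xs)"
    if "\<forall>X\<in>set xs. stars p n X \<le> s" for xs j
  proof (induction j)
    case 0
    then show ?case using that lt by (auto simp: sg_def)
  next
    case (Suc j)
    have "sg (map (pshift p n ^^ Suc j) xs) = sg (map (pshift p n) (map (pshift p n ^^ j) xs))"
      by simp
    also have "\<dots> = map (rot (int p)) (sg (map (pshift p n ^^ j) xs))"
      by (rule sg_map) (use that in \<open>auto simp: stars_pshift_funpow[OF p0]\<close>)
    finally show ?case by (simp add: Suc rot_def comp_def mod_simps add_ac)
  qed
  have range: "set (sg xs) \<subseteq> {0..<int p}" if "\<forall>X\<in>set xs. stars p n X \<le> s" for xs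
    using that lt by (auto simp: sg_def)
  have tau_even_inv: "tau_even (map (\<lambda>a. (a + int j) mod int p) as) = tau_even as"
    if "set as \<subseteq> {0..<int p}" for as j
  proof (induction j)
    case 0
    have "map (\<lambda>a. a mod int p) as = as" using that by (intro map_idI) auto
    then show ?case by simp
  next
    case (Suc j)
    have "map (\<lambda>a. (a + int (Suc j)) mod int p) as = map (rot (int p)) (map (\<lambda>a. (a + int j) mod int p) as)"
      by (simp add: rot_def mod_simps add_ac)
    moreover have "tau_even (map (rot (int p)) (map (\<lambda>a. (a + int j) mod int p) as))
      = tau_even (map (\<lambda>a. (a + int j) mod int p) as)"
      by (rule tau_even_rot) (use p0 in auto)
    ultimately show ?case using Suc by (simp only:)
  qed
  have main: "[eval_chain p n i (\<lambda>xs. tau i (sg xs)) = 1] (mod int p)" if "i \<le> s" for i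
    using that
  proof (induction i)
    case 0
    then show ?case by (simp add: tau_def sg_def)
  next
    case (Suc i)
    \<comment> \<open>A non-invariant primitive of the cocycle of degree \<open>Suc i\<close>. The
      differential turns it into the cocycle of degree \<open>i\<close>: g - 1 takes the head label
      to 1 modulo \<open>p\<close>, the norm takes \<open>desc\<close> to
      \<open>b - a\<close>.\<close>
    define \<rho> where "\<rho> xs = (if even i then hd_tau else desc_tau) (sg xs)" for xs
    have "[eval_chain p n (Suc i) (\<lambda>xs. tau (Suc i) (sg xs)) = eval_chain p n (Suc i) (cobd \<rho>)] (mod int p)"
    proof (rule eval_chain_cong_mod[OF p0])
      fix xs assume "pchain p n (Suc i) xs"
      then have "length xs = Suc (Suc i)" by (simp add: pchain_def)
      then obtain x y ys where xs: "xs = x # y # ys" "length ys = i" by (auto simp: length_Suc_conv)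
      have "cobd \<rho> xs = cobd (if even i then hd_tau else desc_tau) (sg xs)"
        unfolding \<rho>_def sg_def by (rule cobd_map)
      then show "[tau (Suc i) (sg xs) = cobd \<rho> xs] (mod int p)"
        using xs cobd_desc_tau[of "sg ys" "sgn x" "sgn y"] cobd_hd_tau[of "sg (y # ys)" "sgn x"]
        by (auto simp: tau_def sg_def simp del: cobd.simps)
    qed
    also have "[eval_chain p n (Suc i) (cobd \<rho>) = eval_chain p n i (dres p n i \<rho>)] (mod int p)"
      by (rule eval_chain_cobd[OF p0])
    also have "[eval_chain p n i (dres p n i \<rho>) = eval_chain p n i (\<lambda>xs. tau i (sg xs))] (mod int p)"
    proof (rule eval_chain_cong_mod[OF p0])
      fix xs assume "pchain p n i xs"
      then have xs: "length xs = Suc i" "\<forall>X\<in>set xs. stars p n X \<le> s"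
        using Suc.prems by (auto simp: pchain_def)
      note shifted = sg_map_funpow[OF xs(2)]
      show "[dres p n i \<rho> xs = tau i (sg xs)] (mod int p)"
      proof (cases "even i")
        case True
        obtain a as where a: "sg xs = a # as" using xs len[of xs] by (cases "sg xs") auto
        have "hd (sg (map (pshift p n) xs)) = (a + 1) mod int p"
          "tau_even (sg (map (pshift p n) xs)) = tau_even (sg xs)"
          using shifted[of 1] tau_even_inv[OF range[OF xs(2)], of 1] a by simp_all
        then have "dres p n i \<rho> xs = ((a + 1) mod int p - a) * tau_even (sg xs)"
          using True a by (simp add: dres_def \<rho>_def hd_tau_def algebra_simps)
        moreover have "[(a + 1) mod int p - a = 1] (mod int p)"
          by (simp add: cong_def mod_simps)
        ultimately show ?thesis
          using cong_scalar_right[of "(a + 1) mod int p - a" 1 "int p" "tau_even (sg xs)"] True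
          by (simp add: tau_def)
      next
        case False
        then have "length (sg xs) \<ge> 2" using xs len[of xs] by (cases i) auto
        then obtain a b as where a: "sg xs = a # b # as"
          by (cases "sg xs"; cases "tl (sg xs)") auto
        have ab: "a \<in> {0..<int p}" "b \<in> {0..<int p}" "set (b # as) \<subseteq> {0..<int p}"
          using range[OF xs(2)] a by auto
        have "\<rho> (map (pshift p n ^^ j) xs) =
          desc ((a + int j) mod int p) ((b + int j) mod int p) * tau_even (b # as)" for j
          using False shifted[of j] a tau_even_inv[OF ab(3), of j] by (simp add: \<rho>_def)
        then have "dres p n i \<rho> xs =
          (\<Sum>j<p. desc ((a + int j) mod int p) ((b + int j) mod int p)) * tau_even (b # as)"
          using False by (simp add: dres_def sum_distrib_right)
        then show ?thesis
          using cong_scalar_right[OF sum_desc[OF p0 ab(1,2)]] False a by (simp add: tau_def)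
      qed
    qed
    finally show ?case using Suc by (auto intro: cong_trans)
  qed
  show ?thesis
  proof (rule ccontr)
    assume neg: "\<not> ?thesis"
    have "[eval_chain p n s (\<lambda>xs. tau s (sg xs)) = eval_chain p n s (\<lambda>_. 0)] (mod int p)"
    proof (rule eval_chain_cong_mod[OF p0])
      fix xs assume xs: "pchain p n s xs"
      then have "\<not> distinct_adj (map sgn xs)" using neg by auto
      moreover have "sg xs = map int (map sgn xs)" by (simp add: sg_def)
      ultimately have "\<not> distinct_adj (sg xs)"
        by (metis distinct_adj_mapD)
      moreover have "length (sg xs) = Suc s" using xs by (simp add: pchain_def len)
      ultimately have "tau s (sg xs) = 0"
        using tau_even_eq_0 tau_odd_eq_0 by (simp add: tau_def)
      then show "[tau s (sg xs) = 0] (mod int p)" by simp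
    qed
    then have "[1 = 0] (mod int p)"
      using main[OF order_refl] by (auto simp: eval_chain_zero intro: cong_trans cong_sym)
    then show False using p by (simp add: cong_def)
  qed
qed

section \<open>The chromatic number\<close>

lemma periodic_cong:
  fixes T :: "nat \<Rightarrow> 'a"
  assumes "\<And>j. T (j + p) = T j" "[i = j] (mod p)"
  shows "T i = T j"
proof -
  have "T (j + m * p) = T j" for m j
  proof (induction m)
    case (Suc m)
    then show ?case using assms(1)[of "j + m * p"] by (simp add: add_ac)
  qed simp
  then have "T i = T (i mod p)" for i
    by (metis mod_mult_div_eq add.commute mult.commute)
  then show ?thesis using assms(2) by (metis cong_def)
qed

text \<open>Equal shifts by \<open>k < l\<close> give the period \<open>l - k\<close>, which is
  invertible modulo the prime \<open>p\<close>, so that \<open>T\<close> would have period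
  1.\<close>

lemma periodic_aperiodic_inj:
  fixes T :: "nat \<Rightarrow> 'a"
  assumes p: "prime p" and per: "\<And>j. T (j + p) = T j" and nonconst: "T (Suc i) \<noteq> T i"
    and eq: "(\<lambda>j. T (j + k)) = (\<lambda>j. T (j + l))" and "k < p" "l < p"
  shows "k = l"
proof -
  have False if "k < l" "l < p" and eq: "\<And>j. T (j + k) = T (j + l)" for k l
  proof -
    have "coprime (l - k) p"
      using that p by (metis coprime_commute prime_imp_coprime nat_dvd_not_less less_imp_diff_less zero_less_diff)
    then obtain x where x: "[(l - k) * x = Suc 0] (mod p)"
      using cong_solve_coprime_nat by blast
    have shift: "T (j + (l - k)) = T j" for j
    proof -
      have k: "k * (p - 1) + k = k * p"
        using prime_gt_0_nat[OF p] by (cases p) auto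
      have kl: "j + k * (p - 1) + l = j + (l - k) + k * p"
        using that(1) k by simp
      have "T (j + (l - k)) = T (j + k * (p - 1) + l)"
        by (rule periodic_cong[of T p, OF per]) (simp only: cong_def kl mod_mult_self1)
      also have "\<dots> = T (j + k * (p - 1) + k)" using eq by simp
      also have "\<dots> = T j"
        using k by (intro periodic_cong[of T p, OF per]) (simp add: cong_def add.assoc)
      finally show ?thesis .
    qed
    have "T (j + (l - k) * y) = T j" for j y
    proof (induction y)
      case (Suc y)
      then show ?case using shift[of "j + (l - k) * y"] by (simp add: add_ac)
    qed simp
    moreover have "T (i + (l - k) * x) = T (Suc i)"
      using cong_add[OF cong_refl x, of i] by (intro periodic_cong[of T p, OF per]) simp
    ultimately show False using nonconst by simp
  qed
  moreover have "T (j + k) = T (j + l)" for j using eq by meson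
  ultimately show ?thesis using \<open>k < p\<close> \<open>l < p\<close> by (metis linorder_neqE_nat)
qed

text \<open>Fix a representative \<open>R T\<close> in each shift orbit and label \<open>T\<close>
  by the shift that leads from it to \<open>T\<close>; for non-constant \<open>T\<close> this shift
  is unique by \<open>periodic_aperiodic_inj\<close>.\<close>

lemma equivariant_labelling_ex:
  assumes p: "prime p"
  shows "\<exists>L :: (nat \<Rightarrow> 'a) \<Rightarrow> nat. \<forall>T. (\<forall>j. T (j + p) = T j) \<longrightarrow> (\<exists>j. T (Suc j) \<noteq> T j) \<longrightarrow>
    L T < p \<and> L (\<lambda>j. T (Suc j)) = Suc (L T) mod p"
proof -
  have p0: "0 < p" using p by (rule prime_gt_0_nat)
  define orbit where "orbit T = range (\<lambda>k j. T (j + k))" for T :: "nat \<Rightarrow> 'a"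
  define R where "R T = (SOME R. R \<in> orbit T)" for T
  define L where "L T = (SOME k. k < p \<and> T = (\<lambda>j. R T (j + k)))" for T
  have R: "R T \<in> orbit T" for T
    unfolding R_def by (rule someI[of _ T]) (auto simp: orbit_def intro: range_eqI[of _ _ 0])
  have L: "L T < p \<and> T = (\<lambda>j. R T (j + L T))" if per: "\<And>j. T (j + p) = T j" for T
    unfolding L_def
  proof (rule someI_ex)
    obtain m where m: "R T = (\<lambda>j. T (j + m))" using R[of T] by (auto simp: orbit_def)
    \<comment> \<open>\<open>m * (p - 1)\<close> stands for \<open>-m\<close> modulo
      \<open>p\<close>; it undoes the shift by \<open>m\<close> that leads from \<open>T\<close> to
      \<open>R T\<close>.\<close>
    have "T j = T (j + m * (p - 1) mod p + m)" for j
    proof (rule periodic_cong[of T p, OF per])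
      have "[j + m * (p - 1) mod p + m = j + m * (p - 1) + m] (mod p)"
        by (intro cong_add cong_refl) (simp add: cong_def)
      also have "j + m * (p - 1) + m = j + m * p"
        using p0 by (cases p) auto
      also have "[j + m * p = j] (mod p)" by (simp add: cong_def)
      finally show "[j = j + m * (p - 1) mod p + m] (mod p)" by (rule cong_sym)
    qed
    then show "\<exists>k<p. T = (\<lambda>j. R T (j + k))"
      using p0 by (intro exI[of _ "m * (p - 1) mod p"]) (auto simp: m)
  qed
  have "L T < p \<and> L (\<lambda>j. T (Suc j)) = Suc (L T) mod p"
    if per: "\<And>j. T (j + p) = T j" and nonconst: "T (Suc i) \<noteq> T i" for T i
  proof -
    let ?T = "\<lambda>j. T (Suc j)"
    have "orbit ?T = orbit T"
    proof (intro equalityI subsetI)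
      fix S assume "S \<in> orbit T"
      then obtain k where "S = (\<lambda>j. T (j + k))" by (auto simp: orbit_def)
      then have "S = (\<lambda>j. ?T (j + (k + p - 1)))"
        using per p0 by (auto simp: fun_eq_iff simp flip: add.assoc)
      then show "S \<in> orbit ?T" by (auto simp: orbit_def)
    qed (auto simp: orbit_def simp flip: add_Suc_right)
    then have R_eq: "R ?T = R T" by (simp add: R_def)
    define l where "l = Suc (L T) mod p"
    have per_R: "R T (j + p) = R T j" for j
      using R[of T] per by (auto simp: orbit_def) (metis add.assoc add.commute)
    have 1: "?T = (\<lambda>j. R T (j + L ?T))" "L ?T < p"
      using L[of ?T] per by (simp_all add: R_eq flip: add_Suc)
    have "?T = (\<lambda>j. R T (j + Suc (L T)))"
      using L[of T, OF per] by (metis add_Suc_shift)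
    also have "\<dots> = (\<lambda>j. R T (j + l))"
      by (intro ext periodic_cong[of "R T" p, OF per_R]) (simp add: l_def cong_def mod_simps)
    finally have 2: "?T = (\<lambda>j. R T (j + l))" .
    have "T j = R T (j + L T)" for j using L[of T, OF per] by meson
    then have "R T (Suc (i + L T)) \<noteq> R T (i + L T)" using nonconst by (metis add_Suc)
    then have "L ?T = l"
      using 1 2 p0 by (intro periodic_aperiodic_inj[of p "R T", OF p per_R, of "i + L T"]) (auto simp: l_def)
    then show ?thesis using L[of T, OF per] by (simp add: l_def)
  qed
  then show ?thesis by blast
qed

section \<open>Colour sets of completions\<close>

definition completions :: "nat \<Rightarrow> nat \<Rightarrow> (nat \<Rightarrow> nat) \<Rightarrow> (nat \<Rightarrow> nat) set" where
  "completions p n X = {u \<in> Zpn p n. ple p n X u}"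

lemma completions_nonempty:
  assumes "0 < p"
  shows "completions p n X \<noteq> {}"
proof -
  have "(\<lambda>i. if i < n \<and> X i < p then X i else 0) \<in> completions p n X"
    using assms by (auto simp: completions_def Zpn_def ple_def)
  then show ?thesis by blast
qed

text \<open>Where \<open>X\<close> is specified, \<open>v - u\<close> is 1, so its distance to
  \<open>ones p n\<close> is at most the number of stars. Some coordinate is specified, which gives
  \<open>u \<noteq> v\<close>.\<close>

lemma cay_adj_completions:
  assumes p: "2 \<le> p" and u: "u \<in> completions p n X" and v: "v \<in> completions p n (pshift p n X)"
    and st: "stars p n X < n" "real (stars p n X) \<le> real p * sqrt (real n)"
  shows "cay_adj p n (Sset p n) u v"
proof -
  have uv: "u i = X i" "v i = (X i + 1) mod p" if "i < n" "X i < p" for i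
    using u v that by (auto simp: completions_def ple_def pshift_def)
  have "\<exists>i<n. X i < p"
  proof (rule ccontr)
    assume "\<not> ?thesis"
    then have "{i. i < n \<and> p \<le> X i} = {..<n}" by auto
    then show False using st by (simp add: stars_def)
  qed
  then obtain i where i: "i < n" "X i < p" by blast
  have "(X i + 1) mod p \<noteq> X i" using p i by (cases "X i + 1 = p") auto
  then have "u \<noteq> v" using uv[OF i] by auto
  moreover have "vsub p n v u \<in> Sset p n"
  proof -
    have "vsub p n v u i = ones p n i" if "i < n" "X i < p" for i
    proof -
      have "((X i + 1) mod p + p - X i) mod p = ((X i + 1) mod p + (p - X i)) mod p"
        using that by simp
      also have "\<dots> = (X i + 1 + (p - X i)) mod p" by (simp only: mod_simps)
      also have "X i + 1 + (p - X i) = 1 + p" using that by simp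
      also have "(1 + p) mod p = 1 mod p" by (rule mod_add_self2)
      finally show ?thesis using that by (simp add: vsub_def ones_def uv)
    qed
    then have "hamming n (vsub p n v u) (ones p n) \<le> stars p n X"
      unfolding hamming_def stars_def by (intro card_mono) (auto simp: not_less[symmetric])
    then show ?thesis using st p by (auto simp: Sset_def Zpn_def vsub_def)
  qed
  ultimately show ?thesis by (simp add: cay_adj_def)
qed

lemma card_decreasing_chain:
  assumes "sorted_wrt (\<lambda>x y. f y \<le> f x) xs" "distinct_adj (map f xs)" "xs \<noteq> []"
  shows "f (last xs) + length xs \<le> Suc (f (hd xs) :: nat)"
  using assms
proof (induction xs rule: induct_list012)
  case (3 x y zs)
  then show ?case by fastforce
qed auto

text \<open>Label \<open>X\<close> by the position, inside its cyclic orbit, of the sequence of colour sets of the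
  completions of \<open>X, X + 1, X + 2, \<dots>\<close>. Along a chain of partial vectors these sets shrink, so every
  change of the label costs at least one of the at most \<open>p * k\<close> available elements.\<close>

lemma colouring_bound:
  assumes p: "prime p" and n: "0 < n"
    and c: "proper_colouring (Zpn p n) (cay_adj p n (Sset p n)) k c"
    and s: "s < n" "real s \<le> real p * sqrt (real n)"
  shows "s < p * k"
proof -
  have p0: "0 < p" and p2: "2 \<le> p" using p prime_ge_2_nat[OF p] by auto
  let ?g = "pshift p n"
  define C where "C X = c ` completions p n X" for X
  define T where "T X = (\<lambda>j. C ((?g ^^ j) X))" for X
  define rank where "rank X = (\<Sum>j<p. card (T X j))" for X
  obtain L :: "(nat \<Rightarrow> nat set) \<Rightarrow> nat" where L: "\<And>T i. (\<And>j. T (j + p) = T j) \<Longrightarrow> T (Suc i) \<noteq> T i \<Longrightarrow>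
    L T < p \<and> L (\<lambda>j. T (Suc j)) = Suc (L T) mod p"
    using equivariant_labelling_ex[OF p] by metis
  have C_sub: "C X \<subseteq> {..<k}" for X
    using c by (auto simp: C_def completions_def proper_colouring_def)
  then have C_fin: "finite (C X)" for X using finite_subset by blast
  have C_anti: "C Y \<subseteq> C X" if "ple p n X Y" for X Y
    using that by (auto simp: C_def completions_def intro!: imageI intro: ple_trans)
  have T_per: "T X (j + p) = T X j" for X j
    by (simp add: T_def funpow_add pshift_funpow_p[OF p0])
  have T_shift: "T (?g X) = (\<lambda>j. T X (Suc j))" for X
    by (simp add: T_def funpow_Suc_right del: funpow.simps)
  have T_nonconst: "T X (Suc 0) \<noteq> T X 0" if X: "stars p n X \<le> s" for X
  proof
    assume "T X (Suc 0) = T X 0"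
    then have "C (?g X) = C X" by (simp add: T_def)
    moreover obtain u where u: "u \<in> completions p n X" using completions_nonempty[OF p0] by blast
    ultimately have "c u \<in> C (?g X)" by (auto simp: C_def)
    then obtain v where v: "v \<in> completions p n (?g X)" "c v = c u" by (auto simp: C_def)
    have "cay_adj p n (Sset p n) u v"
      using u v s X by (intro cay_adj_completions[OF p2]) auto
    then show False using c u v(1) v(2)[symmetric] by (auto simp: proper_colouring_def completions_def)
  qed
  have LT: "L (T X) < p \<and> L (T (?g X)) = Suc (L (T X)) mod p" if "stars p n X \<le> s" for X
    unfolding T_shift by (rule L[of "T X" 0, OF T_per T_nonconst[OF that]])
  obtain xs where xs: "pchain p n s xs" and adj: "distinct_adj (map (\<lambda>X. L (T X)) xs)"
    using equivariant_chain_distinct_adj[OF p2, of n s "\<lambda>X. L (T X)"] LT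
    by blast
  have T_anti: "T Y j \<subseteq> T X j" if "ple p n X Y" for X Y j
    unfolding T_def by (rule C_anti[OF ple_pshift_funpow[OF p0 that]])
  have T_fin: "finite (T X j)" for X j by (simp add: T_def C_fin)
  have rank_mono: "rank Y \<le> rank X" if "ple p n X Y" for X Y
    unfolding rank_def by (intro sum_mono card_mono T_fin T_anti that)
  \<comment> \<open>Nested sets with equal total size agree for each \<open>j < p\<close>, and
    periodicity extends this to all \<open>j\<close>.\<close>
  have rank_eq: "T Y = T X" if XY: "ple p n X Y" and eq: "rank Y = rank X" for X Y
  proof -
    have "card (T Y j) = card (T X j)" if "j < p" for j
      using eq that unfolding rank_def
      by (intro sum_mono_inv[of "\<lambda>j. card (T Y j)" "{..<p}" "\<lambda>j. card (T X j)"])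
         (auto intro!: card_mono T_fin T_anti[OF XY])
    then have *: "T Y j = T X j" if "j < p" for j
      using that by (intro card_subset_eq T_fin T_anti[OF XY])
    have mod: "T X (j mod p) = T X j" for X j
      by (rule periodic_cong[of "T X" p, OF T_per]) simp
    show ?thesis
      using * p0 by (metis mod ext mod_less_divisor)
  qed
  have sorted: "sorted_wrt (ple p n) xs" using xs by (simp add: pchain_def)
  have "distinct_adj (map rank xs)"
    using sorted adj
  proof (induction xs rule: induct_list012)
    case (3 x y zs)
    then show ?case using rank_eq[of x y] by auto
  qed auto
  moreover have "sorted_wrt (\<lambda>X Y. rank Y \<le> rank X) xs"
    using sorted by (rule sorted_wrt_mono_rel[rotated]) (rule rank_mono)
  moreover have "xs \<noteq> []" using xs by (auto simp: pchain_def)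
  ultimately have "rank (last xs) + length xs \<le> Suc (rank (hd xs))"
    by (intro card_decreasing_chain)
  then have "rank (last xs) + s \<le> rank (hd xs)" using xs by (simp add: pchain_def)
  moreover have rank_le: "rank X \<le> p * k" for X
  proof -
    have "card (T X j) \<le> k" for j
      using card_mono[OF _ C_sub] by (simp add: T_def)
    then have "rank X \<le> (\<Sum>j<p. k)" unfolding rank_def by (intro sum_mono)
    then show ?thesis by simp
  qed
  \<comment> \<open>Completions exist, so the rank at the end of the chain is positive; this makes
    the final inequality strict.\<close>
  moreover have rank_pos: "0 < rank X" for X
  proof -
    have "0 < card (T X 0)"
      using completions_nonempty[OF p0] by (simp add: card_gt_0_iff T_fin) (simp add: T_def C_def)
    also have "\<dots> \<le> rank X"
      unfolding rank_def using p0 by (intro member_le_sum) auto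
    finally show ?thesis .
  qed
  ultimately show ?thesis using rank_le[of "hd xs"] rank_pos[of "last xs"] by linarith
qed

lemma finite_Zpn: "finite (Zpn p n)"
proof (rule finite_subset)
  show "Zpn p n \<subseteq> {x. \<forall>i. (i \<in> {..<n} \<longrightarrow> x i \<in> {..<p}) \<and> (i \<notin> {..<n} \<longrightarrow> x i = 0)}"
    by (auto simp: Zpn_def)
  show "finite {x :: nat \<Rightarrow> nat. \<forall>i. (i \<in> {..<n} \<longrightarrow> x i \<in> {..<p}) \<and> (i \<notin> {..<n} \<longrightarrow> x i = 0)}"
    by (rule finite_set_of_finite_funs) auto
qed

text \<open>An injective numbering of the vertices is proper as \<open>E\<close> is irreflexive, so
  the \<open>LEAST\<close> is attained.\<close>

lemma proper_colouring_chromatic_number: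
  assumes "finite V" "\<And>v. \<not> E v v"
  shows "\<exists>c. proper_colouring V E (chromatic_number V E) c"
  unfolding chromatic_number_def
proof (rule LeastI_ex)
  obtain c where "bij_betw c V {0..<card V}"
    using ex_bij_betw_finite_nat[OF assms(1)] by blast
  then have "proper_colouring V E (card V) c"
    using assms(2) by (force simp: proper_colouring_def bij_betw_def inj_on_def)
  then show "\<exists>k c. proper_colouring V E k c" by blast
qed

theorem chromatic_number_bound:
  assumes p: "prime p" and n: "0 < n"
  shows "sqrt (real n) / real p ^ 3 \<le> real (chromatic_number (Zpn p n) (cay_adj p n (Sset p n)))"
    (is "_ \<le> real ?k")
proof -
  obtain c where c: "proper_colouring (Zpn p n) (cay_adj p n (Sset p n)) ?k c"
    using proper_colouring_chromatic_number[OF finite_Zpn] by (metis cay_adj_def)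
  have p0: "0 < p" and p1: "1 \<le> real p" using prime_ge_1_nat[OF p] by auto
  have "(\<lambda>_. 0) \<in> Zpn p n" using p0 by (simp add: Zpn_def)
  then have k: "1 \<le> ?k" using c by (fastforce simp: proper_colouring_def)
  show ?thesis
  \<comment> \<open>In the first case the claimed bound is at most 1. In the second,
    \<open>p * sqrt n < n\<close>, so \<open>colouring_bound\<close> applies to the integer part of
    \<open>p * sqrt n\<close>.\<close>
  proof (cases "sqrt (real n) \<le> real p")
    case True
    also have "real p \<le> real p ^ 3" using p1 by (simp add: self_le_power)
    finally have "sqrt (real n) / real p ^ 3 \<le> 1" using p1 by simp
    then show ?thesis using k by linarith
  next
    case False
    define s where "s = nat \<lfloor>real p * sqrt (real n)\<rfloor>"
    have s_le: "real s \<le> real p * sqrt (real n)" by (simp add: s_def)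
    also have "\<dots> < sqrt (real n) * sqrt (real n)" using False n by (intro mult_strict_right_mono) auto
    finally have "s < n" by simp
    then have "s < p * ?k" using colouring_bound[OF p n c] s_le by blast
    then have "real s + 1 \<le> real p * real ?k"
      by (metis Suc_leI of_nat_Suc of_nat_le_iff of_nat_mult add.commute)
    moreover have "real p * sqrt (real n) < real s + 1" unfolding s_def by linarith
    ultimately have "real p * sqrt (real n) < real p * real ?k" by linarith
    then have "sqrt (real n) < real ?k" using p0 by simp
    moreover have "sqrt (real n) / real p ^ 3 \<le> sqrt (real n)"
      using mult_left_mono[OF one_le_power[OF p1, of 3], of "sqrt (real n)"] p0 by (simp add: divide_le_eq)
    ultimately show ?thesis by linarith
  qed
qed

section \<open>The independence number\<close>

definition occ :: "nat \<Rightarrow> nat \<Rightarrow> (nat \<Rightarrow> nat) \<Rightarrow> nat" where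
  "occ n a x = card {i. i < n \<and> x i = a}"

lemma card_Zpn_zero_set:
  assumes "A \<subseteq> {..<n}" "0 < p"
  shows "card {x \<in> Zpn p n. {i. i < n \<and> x i = 0} = A} = (p - 1) ^ (n - card A)"
proof -
  let ?B = "{..<n} - A"
  let ?F = "\<lambda>f i. if i \<in> ?B then f i else (0 :: nat)"
  have "bij_betw ?F (PiE ?B (\<lambda>_. {1..<p})) {x \<in> Zpn p n. {i. i < n \<and> x i = 0} = A}"
  proof (rule bij_betw_byWitness[where f' = "\<lambda>x. restrict x ?B"])
    show "?F ` PiE ?B (\<lambda>_. {1..<p}) \<subseteq> {x \<in> Zpn p n. {i. i < n \<and> x i = 0} = A}"
    proof
      fix x assume "x \<in> ?F ` PiE ?B (\<lambda>_. {1..<p})"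
      then obtain f where x: "x = ?F f" and f: "\<And>i. i \<in> ?B \<Longrightarrow> f i \<in> {1..<p}"
        by (auto simp: PiE_iff)
      have "f i < p" "0 < f i" if "i \<in> ?B" for i using f[OF that] by auto
      then show "x \<in> {x \<in> Zpn p n. {i. i < n \<and> x i = 0} = A}"
        using assms by (force simp: x Zpn_def)
    qed
    show "(\<lambda>x. restrict x ?B) ` {x \<in> Zpn p n. {i. i < n \<and> x i = 0} = A} \<subseteq> PiE ?B (\<lambda>_. {1..<p})"
      by (auto simp: Zpn_def Suc_le_eq)
  qed (auto simp: Zpn_def fun_eq_iff PiE_iff extensional_def)
  then have "card {x \<in> Zpn p n. {i. i < n \<and> x i = 0} = A} = card (PiE ?B (\<lambda>_. {1..<p}))"
    by (simp add: bij_betw_same_card)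
  also have "\<dots> = (p - 1) ^ card ?B" by (simp add: card_PiE)
  also have "card ?B = n - card A" using assms by (simp add: card_Diff_subset finite_subset)
  finally show ?thesis .
qed

lemma card_Zpn_occ_zero:
  assumes "0 < p"
  shows "card {x \<in> Zpn p n. occ n 0 x = k} = (n choose k) * (p - 1) ^ (n - k)"
proof -
  let ?\<A> = "{A. A \<subseteq> {..<n} \<and> card A = k}"
  have eq: "{x \<in> Zpn p n. occ n 0 x = k} = (\<Union>A\<in>?\<A>. {x \<in> Zpn p n. {i. i < n \<and> x i = 0} = A})"
    by (auto simp: occ_def)
  have "card {x \<in> Zpn p n. occ n 0 x = k} = (\<Sum>A\<in>?\<A>. card {x \<in> Zpn p n. {i. i < n \<and> x i = 0} = A})"
    unfolding eq
  proof (rule card_UN_disjoint)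
    show "finite ?\<A>" by (rule finite_subset[of _ "Pow {..<n}"]) auto
    show "\<forall>A\<in>?\<A>. finite {x \<in> Zpn p n. {i. i < n \<and> x i = 0} = A}"
      by (simp add: finite_Zpn)
  qed blast
  also have "\<dots> = (\<Sum>A\<in>?\<A>. (p - 1) ^ (n - k))"
  proof (rule sum.cong[OF refl])
    fix A assume "A \<in> ?\<A>"
    then show "card {x \<in> Zpn p n. {i. i < n \<and> x i = 0} = A} = (p - 1) ^ (n - k)"
      using card_Zpn_zero_set[of A n p] assms by simp
  qed
  also have "\<dots> = (n choose k) * (p - 1) ^ (n - k)"
    using n_subsets[of "{..<n}" k] by simp
  finally show ?thesis .
qed

text \<open>The number of zeros of a uniformly random vector is binomial with parameters
  \<open>n\<close> and \<open>1 / p\<close>, and \<open>Bernstein n k (1 / p)\<close> is its point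
  mass at \<open>k\<close>.\<close>

lemma card_Zpn_occ_zero_Bernstein:
  assumes "0 < p" "k \<le> n"
  shows "real (card {x \<in> Zpn p n. occ n 0 x = k}) = real p ^ n * Bernstein n k (1 / real p)"
proof -
  have "real p ^ n = real p ^ k * real p ^ (n - k)" using assms by (simp flip: power_add)
  then have "real p ^ n * Bernstein n k (1 / real p)
      = real (n choose k) * ((real p ^ k * (1 / real p) ^ k) * (real p ^ (n - k) * (1 - 1 / real p) ^ (n - k)))"
    by (simp only: Bernstein_def mult_ac)
  also have "\<dots> = real (n choose k) * ((real p * (1 / real p)) ^ k * (real p * (1 - 1 / real p)) ^ (n - k))"
    by (simp only: power_mult_distrib)
  also have "real p * (1 / real p) = 1" using assms by simp
  also have "real p * (1 - 1 / real p) = real (p - 1)"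
    using assms by (simp add: field_simps of_nat_diff)
  finally show ?thesis using assms by (simp add: card_Zpn_occ_zero)
qed

section \<open>Concentration and shifts of the binomial distribution\<close>

lemma Bernstein_Suc:
  assumes "k < n"
  shows "Bernstein n (Suc k) x * real (Suc k) * (1 - x) = Bernstein n k x * real (n - k) * x"
proof -
  obtain m where m: "n - k = Suc m" using assms by (metis Suc_diff_Suc)
  then have m': "n - Suc k = m" by simp
  have absorb: "real (Suc k) * real (n choose Suc k) = real (n - k) * real (n choose k)"
    using binomial_absorb_comp[of n k] binomial_absorption[of k n]
    by (metis of_nat_mult)
  have "Bernstein n (Suc k) x * real (Suc k) * (1 - x)
      = real (Suc k) * real (n choose Suc k) * (x ^ Suc k * (1 - x) ^ Suc m)"
    by (simp add: Bernstein_def m' mult_ac)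
  also have "\<dots> = Bernstein n k x * real (n - k) * x"
    unfolding absorb by (simp add: Bernstein_def m mult_ac)
  finally show ?thesis .
qed

lemma Bernstein_variance: "(\<Sum>k\<le>n. (real k - real n * x)\<^sup>2 * Bernstein n k x) = real n * x * (1 - x)"
proof -
  have *: "(a - b)\<^sup>2 * x = a * (a - 1) * x + (1 - 2 * b) * (a * x) + b\<^sup>2 * x" for a b x :: real
    by (simp add: algebra_simps power2_eq_square)
  show ?thesis
    by (simp add: * sum.distrib flip: sum_distrib_left) (simp add: algebra_simps power2_eq_square)
qed

text \<open>Chebyshev's inequality at deviation \<open>sqrt n\<close>, with
  \<open>x * (1 - x) \<le> 1 / 4\<close>.\<close>

lemma Bernstein_concentration:
  assumes "0 \<le> x" "x \<le> 1" "0 < n"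
  shows "(\<Sum>k | k \<le> n \<and> \<bar>real k - real n * x\<bar> < sqrt (real n). Bernstein n k x) \<ge> 3 / 4"
proof -
  let ?W = "{k. k \<le> n \<and> \<bar>real k - real n * x\<bar> < sqrt (real n)}"
  let ?O = "{k. k \<le> n \<and> sqrt (real n) \<le> \<bar>real k - real n * x\<bar>}"
  have "real n * (\<Sum>k\<in>?O. Bernstein n k x) \<le> (\<Sum>k\<in>?O. (real k - real n * x)\<^sup>2 * Bernstein n k x)"
    unfolding sum_distrib_left
  proof (intro sum_mono mult_right_mono Bernstein_nonneg assms)
    fix k assume "k \<in> ?O"
    then have "(sqrt (real n))\<^sup>2 \<le> \<bar>real k - real n * x\<bar>\<^sup>2" by (intro power_mono) auto
    then show "real n \<le> (real k - real n * x)\<^sup>2" by simp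
  qed
  also have "\<dots> \<le> (\<Sum>k\<le>n. (real k - real n * x)\<^sup>2 * Bernstein n k x)"
    by (rule sum_mono2) (auto intro!: mult_nonneg_nonneg Bernstein_nonneg assms)
  also have "\<dots> = real n * (x * (1 - x))" by (simp add: Bernstein_variance)
  finally have "(\<Sum>k\<in>?O. Bernstein n k x) \<le> x * (1 - x)" using assms by simp
  also have "\<dots> \<le> 1 / 4"
    using zero_le_power2[of "x - 1 / 2"] by (simp add: power2_eq_square algebra_simps)
  finally have "(\<Sum>k\<in>?O. Bernstein n k x) \<le> 1 / 4" .
  moreover have "(\<Sum>k\<le>n. Bernstein n k x) = (\<Sum>k\<in>?W. Bernstein n k x) + (\<Sum>k\<in>?O. Bernstein n k x)"
  proof -
    have "{..n} = ?W \<union> ?O" by auto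
    moreover have "?W \<inter> ?O = {}" by auto
    ultimately show ?thesis by (simp add: sum.union_disjoint)
  qed
  ultimately show ?thesis by simp
qed

lemma exp_le_one_minus:
  assumes "0 \<le> e" "e \<le> 1 / 2"
  shows "exp (- 2 * e) \<le> 1 - (e :: real)"
proof -
  have "1 + 2 * e \<le> exp (2 * e)" by (rule exp_ge_add_one_self)
  then have "exp (- 2 * e) \<le> 1 / (1 + 2 * e)"
    using assms by (simp add: exp_minus field_simps)
  also have "\<dots> \<le> 1 - e"
    using assms mult_left_mono[of e "1 / 2" e] by (simp add: field_simps)
  finally show ?thesis .
qed

text \<open>By \<open>Bernstein_Suc\<close> the ratio of consecutive masses at \<open>K\<close> is
  \<open>(n - K) / ((K + 1) * (p - 1))\<close>. Within \<open>O(sqrt n)\<close> of the mean it is at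
  least \<open>1 - C / sqrt n\<close>, hence at least \<open>exp (- 2 * C / sqrt n)\<close>.\<close>

lemma Bernstein_shift:
  fixes p n :: nat
  assumes p: "2 \<le> p" and M: "1 \<le> M"
    and n: "2 * C \<le> sqrt (real n)" and C: "C = 2 * real p ^ 2 * (M + 1)"
    and lo: "real n / p - sqrt n \<le> real k" and hi: "real k + real s \<le> real n / p + M * sqrt n"
  shows "exp (- 2 * C / sqrt n) ^ s * Bernstein n k (1 / real p) \<le> Bernstein n (k + s) (1 / real p)"
  using hi
proof (induction s)
  case (Suc s)
  define r where "r = sqrt (real n)"
  have p': "2 \<le> real p" using p by simp
  have "2 * real p * (2 * (M + 1)) \<le> real p ^ 2 * (2 * (M + 1))"
    using p' M by (intro mult_right_mono) (auto simp: power2_eq_square)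
  then have C_ge': "4 * (real p * (M + 1)) \<le> C" by (simp add: C algebra_simps)
  moreover have "1 * M \<le> real p * (M + 1)" "real p * 1 \<le> real p * (M + 1)"
    using p' M by (intro mult_mono; simp)+
  ultimately have C_ge: "4 * M \<le> C" "4 * real p \<le> C" by simp_all
  then have C1: "4 \<le> C" using M by simp
  have r: "2 * C \<le> r" "real n = r * r" using n by (auto simp: r_def)
  have r8: "8 \<le> r" using r(1) C1 by simp
  let ?K = "real (k + s)" and ?q = "real p"
  have K_lo: "r * r / ?q - r \<le> ?K" using lo by (simp add: r_def)
  have K_hi: "?K + 1 \<le> r * r / ?q + M * r" using Suc.prems by (simp add: r_def)
  have "2 * ?q \<le> r" using r(1) C_ge C1 by linarith
  then have "r * (2 * ?q) \<le> r * r" using r8 by (intro mult_left_mono) linarith+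
  then have "r \<le> r * r / (2 * ?q)" using p' by (simp add: pos_le_divide_eq)
  moreover have "r * r / ?q = 2 * (r * r / (2 * ?q))" by simp
  ultimately have K_lo': "r * r / (2 * ?q) \<le> ?K" using K_lo by linarith
  have "M < r / 2" using r(1) C_ge C1 M by linarith
  then have "M * r < r / 2 * r" using r8 by (intro mult_strict_right_mono) linarith+
  then have "M * r < r * r / 2" by simp
  moreover have "r * r / ?q \<le> r * r / 2" using p' by (intro divide_left_mono) auto
  ultimately have "?K + 1 < real n" using K_hi r(2) by linarith
  then have kn: "k + s < n" by linarith
  have "r * r - ?q * (r * r / ?q + M * r) \<le> r * r - ?q * (?K + 1)"
    using K_hi p' by (intro diff_left_mono mult_left_mono) auto
  then have "- (?q * M * r) \<le> r * r - ?q * (?K + 1)" using p' by (simp add: algebra_simps)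
  \<comment> \<open>\<open>C\<close> is chosen so that \<open>C / r\<close> times the lower bound
    \<open>r * r / (2 * p)\<close> for \<open>K\<close> is \<open>p * (M + 1) * r\<close>.\<close>
  moreover have "?q * M * r \<le> C / r * ((?K + 1) * (?q - 1))"
  proof -
    have "?q * M * r \<le> C / r * (r * r / (2 * ?q))"
      using r8 p' M by (simp add: C field_simps power2_eq_square)
    also have "\<dots> \<le> C / r * ((?K + 1) * 1)"
      using K_lo' r8 C1 by (intro mult_left_mono) auto
    also have "\<dots> \<le> C / r * ((?K + 1) * (?q - 1))"
      using p' r8 C1 by (intro mult_left_mono) auto
    finally show ?thesis .
  qed
  ultimately have "(1 - C / r) * ((?K + 1) * (?q - 1)) \<le> r * r - ?K"
    by (simp add: algebra_simps)
  then have *: "(1 - C / r) * (real (Suc (k + s)) * (?q - 1)) \<le> real (n - (k + s))"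
    using kn r by (simp add: of_nat_diff add.commute)
  have "Bernstein n (Suc (k + s)) (1 / ?q) * real (Suc (k + s)) * (1 - 1 / ?q)
      = Bernstein n (k + s) (1 / ?q) * real (n - (k + s)) * (1 / ?q)"
    by (rule Bernstein_Suc[OF kn])
  then have step: "Bernstein n (Suc (k + s)) (1 / ?q) * (real (Suc (k + s)) * (?q - 1))
      = Bernstein n (k + s) (1 / ?q) * real (n - (k + s))"
    using p' by (simp add: field_simps)
  have nonneg: "0 \<le> Bernstein n j (1 / ?q)" for j
    using p' by (intro Bernstein_nonneg) auto
  have "(1 - C / r) * Bernstein n (k + s) (1 / ?q) * (real (Suc (k + s)) * (?q - 1))
    \<le> Bernstein n (Suc (k + s)) (1 / ?q) * (real (Suc (k + s)) * (?q - 1))"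
    unfolding step using mult_left_mono[OF * nonneg[of "k + s"]] by (simp add: mult_ac)
  then have le: "(1 - C / r) * Bernstein n (k + s) (1 / ?q) \<le> Bernstein n (Suc (k + s)) (1 / ?q)"
    by (rule mult_right_le_imp_le) (use p' in simp)
  have e: "exp (- 2 * (C / r)) \<le> 1 - C / r"
    using r r8 C1 by (intro exp_le_one_minus) (auto simp: field_simps)
  have "exp (- 2 * C / r) ^ Suc s * Bernstein n k (1 / ?q)
    = exp (- 2 * (C / r)) * (exp (- 2 * C / r) ^ s * Bernstein n k (1 / ?q))"
    by simp
  also have "\<dots> \<le> (1 - C / r) * Bernstein n (k + s) (1 / ?q)"
    using Suc e nonneg order_trans[OF exp_ge_zero e] by (intro mult_mono) (auto simp: r_def)
  also note le
  finally show ?case by (simp add: r_def)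
qed simp

text \<open>The central window, of mass at least 3/4, is moved up by about
  \<open>(p + 1) * sqrt n\<close>, hence past the threshold. By \<open>Bernstein_shift\<close> this
  costs a factor that does not depend on \<open>n\<close>.\<close>

lemma card_many_zeros:
  assumes p: "2 \<le> p"
  shows "\<exists>c>0. \<exists>N. \<forall>n\<ge>N. c * real p ^ n
    \<le> real (card {x \<in> Zpn p n. real n / p + real p * sqrt n < real (occ n 0 x)})"
proof -
  \<comment> \<open>The constant of \<open>Bernstein_shift\<close> for \<open>M = p + 3\<close>: the
    window reaches \<open>sqrt n\<close> above the mean, and the shift is at most
    \<open>(p + 2) * sqrt n\<close>.\<close>
  define C where "C = 2 * real p ^ 2 * (real p + 3 + 1)"
  define c where "c = exp (- 2 * C * (real p + 2)) * (3 / 4)"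
  have C1: "1 \<le> C" "1 \<le> real p" using p by (auto simp: C_def intro!: mult_ge1_I)
  have main: "c * real p ^ n \<le> real (card {x \<in> Zpn p n. real n / p + real p * sqrt n < real (occ n 0 x)})"
    if n: "nat \<lceil>(2 * C)\<^sup>2\<rceil> \<le> n" for n
  proof -
    let ?r = "sqrt (real n)" and ?B = "\<lambda>k. Bernstein n k (1 / real p)"
    have "(2 * C)\<^sup>2 \<le> real n" using n by (simp add: nat_le_iff ceiling_le_iff)
    then have r: "2 * C \<le> ?r" by (rule real_le_rsqrt)
    then have "1 \<le> ?r" using C1 by linarith
    moreover from this have "0 < n" by (cases n) auto
    ultimately have r1: "1 \<le> ?r" "0 < n" by auto
    define s where "s = nat \<lceil>(real p + 1) * ?r\<rceil>"
    have s_ge: "(real p + 1) * ?r \<le> real s" unfolding s_def by linarith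
    have "real s \<le> (real p + 1) * ?r + 1" unfolding s_def using r1 by (simp add: of_nat_nat)
    moreover have "(real p + 2) * ?r = (real p + 1) * ?r + ?r" by (simp add: algebra_simps)
    ultimately have s_le: "real s \<le> (real p + 2) * ?r" using r1 by linarith
    let ?W = "{k. k \<le> n \<and> \<bar>real k - real n * (1 / real p)\<bar> < ?r}"
    let ?H = "{k. k \<le> n \<and> real n / p + real p * ?r < real k}"
    have nonneg: "0 \<le> ?B j" for j
      using p by (intro Bernstein_nonneg) auto
    have "exp (- 2 * C * (real p + 2)) \<le> exp (real s * (- 2 * C / ?r))"
      using r1 C1 mult_left_mono[OF s_le, of "2 * C"] by (simp add: field_simps)
    also have "\<dots> = exp (- 2 * C / ?r) ^ s" by (rule exp_of_nat_mult)
    finally have e: "exp (- 2 * C * (real p + 2)) \<le> exp (- 2 * C / ?r) ^ s" .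
    have shift: "exp (- 2 * C * (real p + 2)) * ?B k \<le> ?B (k + s)" if "k \<in> ?W" for k
    proof -
      have "exp (- 2 * C * (real p + 2)) * ?B k \<le> exp (- 2 * C / ?r) ^ s * ?B k"
        by (rule mult_right_mono[OF e nonneg])
      also have "\<dots> \<le> ?B (k + s)"
      proof (rule Bernstein_shift[OF p _ r, of "real p + 3"])
        show "real n / p - ?r \<le> real k" using that by auto
        show "real k + real s \<le> real n / p + (real p + 3) * ?r"
          using that s_le by (auto simp: algebra_simps abs_less_iff)
      qed (auto simp: C_def)
      finally show ?thesis .
    qed
    have "c \<le> exp (- 2 * C * (real p + 2)) * (\<Sum>k\<in>?W. ?B k)"
      unfolding c_def using Bernstein_concentration[of "1 / real p" n] r1 p by (intro mult_left_mono) auto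
    also have "\<dots> \<le> (\<Sum>k\<in>?W. ?B (k + s))"
      unfolding sum_distrib_left by (intro sum_mono shift)
    also have "\<dots> = (\<Sum>k\<in>(\<lambda>k. k + s) ` ?W. ?B k)"
      by (subst sum.reindex) (auto simp: inj_on_def)
    \<comment> \<open>Indices moved beyond \<open>n\<close> carry a zero binomial
      coefficient.\<close>
    also have "\<dots> = (\<Sum>k\<in>(\<lambda>k. k + s) ` ?W \<inter> {..n}. ?B k)"
      by (rule sum.mono_neutral_right) (auto simp: Bernstein_def)
    also have "\<dots> \<le> (\<Sum>k\<in>?H. ?B k)"
    proof (intro sum_mono2 nonneg)
      show "(\<lambda>k. k + s) ` ?W \<inter> {..n} \<subseteq> ?H"
        using s_ge by (auto simp: algebra_simps abs_less_iff)
    qed simp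
    finally have "real p ^ n * c \<le> real p ^ n * (\<Sum>k\<in>?H. ?B k)"
      by (intro mult_left_mono) auto
    also have "\<dots> = real (\<Sum>k\<in>?H. card {x \<in> Zpn p n. occ n 0 x = k})"
      using p by (simp add: sum_distrib_left card_Zpn_occ_zero_Bernstein)
    also have "(\<Sum>k\<in>?H. card {x \<in> Zpn p n. occ n 0 x = k}) = card (\<Union>k\<in>?H. {x \<in> Zpn p n. occ n 0 x = k})"
      by (rule card_UN_disjoint[symmetric]) (auto simp: finite_Zpn)
    also have "\<dots> \<le> card {x \<in> Zpn p n. real n / p + real p * ?r < real (occ n 0 x)}"
      by (intro card_mono) (auto simp: finite_Zpn)
    finally show ?thesis by (simp add: mult.commute)
  qed
  show ?thesis
  proof (intro exI conjI allI impI)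
    show "0 < c" by (simp add: c_def)
  qed (rule main)
qed

section \<open>From many zeros to an independent set\<close>

lemma sum_occ:
  assumes "x \<in> Zpn p n"
  shows "(\<Sum>a<p. occ n a x) = n"
proof -
  have "(\<Sum>a<p. occ n a x) = card (\<Union>a<p. {i. i < n \<and> x i = a})"
    unfolding occ_def by (rule card_UN_disjoint[symmetric]) auto
  also have "(\<Union>a<p. {i. i < n \<and> x i = a}) = {..<n}"
    using assms by (auto simp: Zpn_def)
  finally show ?thesis by simp
qed

text \<open>More than \<open>n / p\<close> zeros leave an average below \<open>n / p\<close> for the
  \<open>p - 1\<close> nonzero values, so some value \<open>a\<close> occurs at most
  \<open>n / p\<close> times. Swapping \<open>1\<close> and \<open>a\<close> keeps the zeros and
  injects \<open>J a\<close> into \<open>J 1\<close>.\<close>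

lemma card_few_ones:
  assumes p: "2 \<le> p" and t: "real n / p \<le> t"
  shows "card {x \<in> Zpn p n. t < real (occ n 0 x)}
    \<le> (p - 1) * card {x \<in> Zpn p n. t < real (occ n 0 x) \<and> real (occ n 1 x) \<le> real n / p}"
proof -
  define J where "J a = {x \<in> Zpn p n. t < real (occ n 0 x) \<and> real (occ n a x) \<le> real n / p}" for a
  have fin: "finite (J a)" for a by (simp add: J_def finite_Zpn)
  have "{x \<in> Zpn p n. t < real (occ n 0 x)} \<subseteq> (\<Union>a\<in>{1..<p}. J a)"
  proof
    fix x assume x: "x \<in> {x \<in> Zpn p n. t < real (occ n 0 x)}"
    have "\<exists>a\<in>{1..<p}. real (occ n a x) \<le> real n / p"
    proof (rule ccontr)
      assume "\<not> ?thesis"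
      then have "(\<Sum>a\<in>{1..<p}. real n / p) \<le> (\<Sum>a\<in>{1..<p}. real (occ n a x))"
        by (intro sum_mono) (auto simp: not_le less_imp_le)
      also have "\<dots> = real n - real (occ n 0 x)"
      proof -
        have "{..<p} = insert 0 {1..<p}" using p by auto
        then have "occ n 0 x + (\<Sum>a\<in>{1..<p}. occ n a x) = n"
          using sum_occ[of x p n] x by simp
        then show ?thesis by (metis add_diff_cancel_left' of_nat_add of_nat_sum)
      qed
      also have "\<dots> < real n - real n / p" using x t by simp
      finally show False using p by (simp add: field_simps of_nat_diff)
    qed
    then show "x \<in> (\<Union>a\<in>{1..<p}. J a)" using x by (auto simp: J_def)
  qed
  then have "card {x \<in> Zpn p n. t < real (occ n 0 x)} \<le> card (\<Union>a\<in>{1..<p}. J a)"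
    by (intro card_mono) (auto simp: fin)
  also have "\<dots> \<le> (\<Sum>a\<in>{1..<p}. card (J a))"
    by (rule card_UN_le) simp
  also have "\<dots> \<le> (\<Sum>a\<in>{1..<p}. card (J 1))"
  proof (rule sum_mono)
    fix a assume a: "a \<in> {1..<p}"
    let ?\<tau> = "Transposition.transpose 1 a"
    have occ_transpose: "occ n b (\<lambda>i. ?\<tau> (x i)) = occ n (?\<tau> b) x" for b x
    proof -
      have "?\<tau> y = b \<longleftrightarrow> y = ?\<tau> b" for y by (metis Transposition.transpose_involutory)
      then show ?thesis by (simp only: occ_def)
    qed
    show "card (J a) \<le> card (J 1)"
    proof (rule card_inj_on_le[OF _ _ fin])
      show "inj_on (\<lambda>x i. ?\<tau> (x i)) (J a)"
        by (rule inj_onI) (auto simp: fun_eq_iff dest: injD[OF Transposition.inj_transpose])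
      show "(\<lambda>x i. ?\<tau> (x i)) ` J a \<subseteq> J 1"
      proof
        fix y assume "y \<in> (\<lambda>x i. ?\<tau> (x i)) ` J a"
        then obtain x where y: "y = (\<lambda>i. ?\<tau> (x i))" and x: "x \<in> J a" by blast
        have "?\<tau> 0 = 0" "?\<tau> 1 = a" using a by (simp_all add: Transposition.transpose_def)
        then have "occ n 0 y = occ n 0 x" "occ n 1 y = occ n a x"
          unfolding y occ_transpose by simp_all
        moreover have "y \<in> Zpn p n"
          using x a p by (auto simp: y J_def Zpn_def Transposition.transpose_def)
        ultimately show "y \<in> J 1" using x by (simp add: J_def)
      qed
    qed
  qed
  also have "\<dots> = (p - 1) * card (J 1)" by simp
  finally show ?thesis by (simp add: J_def)
qed

text \<open>If \<open>v - u\<close> is close to the all-ones vector, then \<open>v\<close> has about as many ones as \<open>u\<close> has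
  zeros.\<close>

lemma independent_few_ones:
  assumes p: "2 \<le> p"
  shows "independent_set (Zpn p n) (cay_adj p n (Sset p n))
    {x \<in> Zpn p n. real n / p + real p * sqrt n < real (occ n 0 x) \<and> real (occ n 1 x) \<le> real n / p}"
    (is "independent_set _ _ ?I")
proof -
  have "vsub p n v u \<notin> Sset p n" if u: "u \<in> ?I" and v: "v \<in> ?I" for u v
  proof
    assume S: "vsub p n v u \<in> Sset p n"
    have "v i = 1" if "i < n" "u i = 0" "vsub p n v u i = ones p n i" for i
      using that v p by (simp add: vsub_def ones_def Zpn_def)
    then have "{i. i < n \<and> u i = 0} \<subseteq> {i. i < n \<and> v i = 1} \<union> {i. i < n \<and> vsub p n v u i \<noteq> ones p n i}"
      by auto
    then have "occ n 0 u \<le> card ({i. i < n \<and> v i = 1} \<union> {i. i < n \<and> vsub p n v u i \<noteq> ones p n i})"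
      unfolding occ_def by (intro card_mono) auto
    also have "\<dots> \<le> occ n 1 v + hamming n (vsub p n v u) (ones p n)"
      unfolding occ_def hamming_def by (rule card_Un_le)
    finally have "real (occ n 0 u) \<le> real (occ n 1 v) + real (hamming n (vsub p n v u) (ones p n))"
      by linarith
    \<comment> \<open>The gap \<open>p * sqrt n\<close> between the two thresholds is the radius of
      \<open>Sset p n\<close>, and the bound on the zeros is strict.\<close>
    then show False using u v S by (simp add: Sset_def)
  qed
  then show ?thesis by (auto simp: independent_set_def cay_adj_def)
qed

lemma card_le_independence_number:
  assumes "finite V" "independent_set V E I"
  shows "card I \<le> independence_number V E"
proof -
  have "finite {I. independent_set V E I}"
    by (rule finite_subset[of _ "Pow V"]) (use assms in \<open>auto simp: independent_set_def\<close>)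
  then show ?thesis
    unfolding independence_number_def using assms by (intro Max_ge) auto
qed

lemma independence_number_bound:
  assumes p: "2 \<le> p"
  shows "\<exists>c>0. \<exists>N. \<forall>n\<ge>N.
    c * real p ^ n \<le> real (independence_number (Zpn p n) (cay_adj p n (Sset p n)))"
proof -
  obtain c N where c: "0 < c" and N: "\<And>n. N \<le> n \<Longrightarrow> c * real p ^ n
    \<le> real (card {x \<in> Zpn p n. real n / p + real p * sqrt n < real (occ n 0 x)})"
    using card_many_zeros[OF p] by blast
  have "c / real (p - 1) * real p ^ n \<le> real (independence_number (Zpn p n) (cay_adj p n (Sset p n)))"
    if "N \<le> n" for n
  proof -
    let ?t = "real n / p + real p * sqrt n"
    let ?I = "{x \<in> Zpn p n. ?t < real (occ n 0 x) \<and> real (occ n 1 x) \<le> real n / p}"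
    have "c * real p ^ n \<le> real (card {x \<in> Zpn p n. ?t < real (occ n 0 x)})"
      by (rule N[OF that])
    also have "\<dots> \<le> real ((p - 1) * card ?I)"
      using card_few_ones[OF p, of n ?t] by (simp only: of_nat_le_iff) simp
    also have "\<dots> \<le> real (p - 1) * real (independence_number (Zpn p n) (cay_adj p n (Sset p n)))"
      using card_le_independence_number[OF finite_Zpn independent_few_ones[OF p]]
      by (simp add: mult_left_mono)
    finally show ?thesis using p by (simp add: field_simps)
  qed
  then show ?thesis using c p by (intro exI[of _ "c / real (p - 1)"]) auto
qed

theorem theorem1p4:
  shows "(\<forall>p n. prime p \<longrightarrow> n > 0 \<longrightarrow>
           real (chromatic_number (Zpn p n) (cay_adj p n (Sset p n)))
             \<ge> sqrt (real n) / real p ^ 3)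
       \<and> (\<forall>p. prime p \<longrightarrow> (\<exists>c>0. \<exists>N. \<forall>n\<ge>N.
           real (independence_number (Zpn p n) (cay_adj p n (Sset p n)))
             \<ge> c * real p ^ n))"
  using chromatic_number_bound independence_number_bound prime_ge_2_nat by blast

end
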